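(* An argument $\Gamma\rhd\Delta$ is $(0,1]$-preservation valid if and only if it is subvaluationistically valid.
   Context: Language: $\mathcal{L}$ is the propositional language with countably infinitely many atomic sentences and connectives $\neg,\lor$ (other classical connectives defined as usual). An argument $\Gamma\rhd\Delta$ is a pair of finite (possibly empty) sets $\Gamma,\Delta$ of sentences of $\mathcal{L}$. A probabilistic model is $\langle W,\mathcal{A},[\![\cdot]\!],P\rangle$ where $W$ is a nonempty set (of worlds); $\mathcal{A}\subseteq\mathcal{P}(W)$ contains $\emptyset$ and is closed under complement in $W$ and binary union; $[\![\cdot]\!]:\mathcal{L}\to\mathcal{A}$ satisfies $[\![\neg\phi]\!]=W\setminus[\![\phi]\!]$ and $[\![\phi\lor\psi]\!]=[\![\phi]\!]\cup[\![\psi]\!]$; and $P:\mathcal{A}\to[0,1]$ is a finitely additive probability ($P(\emptyset)=0$, $P(W\setminus A)=1-P(A)$, and $P(A\cup B)=P(A)+P(B)$ for disjoint $A,B\in\mathcal{A}$). Write $P(\phi)$ for $P([\![\phi]\!])$. For a set $\alpha\subseteq[0,1]$, the argument $\Gamma\rhd\Delta$ is $\alpha$-preservation valid iff in every probabilistic model, if $P(\gamma)\in\alpha$ for every $\gamma\in\Gamma$, then $P(\delta)\in\alpha$ for some $\delta\in\Delta$. The argument $\Gamma\rhd\Delta$ is subvaluationistically valid iff in every probabilistic model, if $[\![\gamma]\!]\neq\emptyset$ for every $\gamma\in\Gamma$, then $[\![\delta]\!]\neq\emptyset$ for some $\delta\in\Delta$. *)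

theory Defs
  imports "HOL-Analysis.Measure_Space"
begin

datatype fm = Atom nat | Neg fm | Or fm fm

text \<open>The probability \<open>P\<close> is a total function on sets of worlds, but only its values on the algebra
  \<open>A\<close> are constrained or used. The library predicate \<open>algebra W A\<close> amounts to \<open>A \<subseteq> Pow W\<close> containing
  the empty set and being closed under complement in \<open>W\<close> and binary union (\<open>algebra_iff_Un\<close>);
  \<open>additive A P\<close> is additivity for disjoint members of \<open>A\<close>.\<close>

locale prob_model = algebra W A
  for W :: "'w set" and A :: "'w set set" +
  fixes I :: "fm \<Rightarrow> 'w set"
    and P :: "'w set \<Rightarrow> real"
  assumes worlds_nonempty: "W \<noteq> {}"
    and I_in: "I \<phi> \<in> A"
    and I_Neg: "I (Neg \<phi>) = W - I \<phi>"
    and I_Or: "I (Or \<phi> \<psi>) = I \<phi> \<union> I \<psi>"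
    and P_range: "X \<in> A \<Longrightarrow> P X \<in> {0..1}"
    and P_empty: "P {} = 0"
    and P_compl: "X \<in> A \<Longrightarrow> P (W - X) = 1 - P X"
    and P_additive: "additive A P"

text \<open>HOL cannot quantify over types inside a formula, so validity is indexed by the type \<open>'w\<close> in which
  worlds live; the set of worlds may be any nonempty subset of it. Validity over all models is validity
  for every \<open>'w\<close>.\<close>

definition preservation_valid :: "'w itself \<Rightarrow> real set \<Rightarrow> fm set \<Rightarrow> fm set \<Rightarrow> bool" where
  "preservation_valid TYPE('w) \<alpha> \<Gamma> \<Delta> \<longleftrightarrow>
     (\<forall>(W :: 'w set) A I P. prob_model W A I P \<longrightarrow>
        (\<forall>\<gamma>\<in>\<Gamma>. P (I \<gamma>) \<in> \<alpha>) \<longrightarrow> (\<exists>\<delta>\<in>\<Delta>. P (I \<delta>) \<in> \<alpha>))"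

definition subvaluationistically_valid :: "'w itself \<Rightarrow> fm set \<Rightarrow> fm set \<Rightarrow> bool" where
  "subvaluationistically_valid TYPE('w) \<Gamma> \<Delta> \<longleftrightarrow>
     (\<forall>(W :: 'w set) A I P. prob_model W A I P \<longrightarrow>
        (\<forall>\<gamma>\<in>\<Gamma>. I \<gamma> \<noteq> {}) \<longrightarrow> (\<exists>\<delta>\<in>\<Delta>. I \<delta> \<noteq> {}))"

end

theory Submission
  imports Defs
begin

text \<open>If all premises are possible in a model, pick a witnessing world for each and replace the
  probability by the uniform one on these finitely many worlds: every premise becomes positive, and
  whatever is positive is possible. Conversely, if every conclusion has probability zero in a model,
  so does their finite union; deleting it from the worlds leaves a model in which no conclusion is
  possible, while premises of positive probability remain so.\<close>

context prob_model
begin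

lemma P_mono:
  assumes "X \<in> A" "Y \<in> A" "X \<subseteq> Y"
  shows "P X \<le> P Y"
proof -
  have "P (X \<union> (Y - X)) = P X + P (Y - X)"
    using P_additive assms by (intro additiveD) auto
  moreover have "X \<union> (Y - X) = Y"
    using assms(3) by auto
  ultimately show ?thesis
    using P_range[of "Y - X"] assms by auto
qed

lemma P_null_Un:
  assumes "X \<in> A" "Y \<in> A" "P X = 0" "P Y = 0"
  shows "P (X \<union> Y) = 0"
proof -
  have "P (X \<union> (Y - X)) = P X + P (Y - X)"
    using P_additive assms by (intro additiveD) auto
  moreover have "P (Y - X) \<le> P Y"
    using assms by (intro P_mono) auto
  moreover have "0 \<le> P (Y - X)"
    using P_range[of "Y - X"] assms by auto
  ultimately show ?thesis
    using assms by simp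
qed

text \<open>Used for the union of all conclusions. Since \<open>P\<close> is only finitely additive,
  the induction needs \<open>J\<close> finite.\<close>

lemma P_null_UN:
  assumes "finite J" "\<And>j. j \<in> J \<Longrightarrow> F j \<in> A" "\<And>j. j \<in> J \<Longrightarrow> P (F j) = 0"
  shows "P (\<Union>j\<in>J. F j) = 0"
  using assms
proof (induction J)
  case empty
  then show ?case by (simp add: P_empty)
next
  case (insert j J)
  have "(\<Union>j\<in>J. F j) \<in> A"
    using insert.hyps insert.prems by (intro finite_UN) auto
  then show ?case
    using insert by (auto intro!: P_null_Un)
qed

text \<open>Conditioning on an event of probability 1 does not change probabilities, so the same
  \<open>P\<close> serves the smaller model without rescaling.\<close>

lemma prob_model_restrict:
  assumes "V \<in> A" "P V = 1"
  shows "prob_model V ((\<inter>) V ` A) (\<lambda>\<phi>. V \<inter> I \<phi>) P"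
proof -
  have VW: "V \<subseteq> W"
    using assms(1) sets_into_space by blast
  have sub: "(\<inter>) V ` A \<subseteq> A"
    using assms(1) by auto
  show ?thesis
  proof (intro prob_model.intro prob_model_axioms.intro)
    show "algebra V ((\<inter>) V ` A)"
      using assms(1) by (rule restricted_algebra)
    show "V \<noteq> {}"
      using assms(2) P_empty by auto
    show "V \<inter> I \<phi> \<in> (\<inter>) V ` A" for \<phi>
      by (intro imageI I_in)
    show "V \<inter> I (Neg \<phi>) = V - V \<inter> I \<phi>" for \<phi>
      using VW by (auto simp: I_Neg)
    show "V \<inter> I (Or \<phi> \<psi>) = V \<inter> I \<phi> \<union> V \<inter> I \<psi>" for \<phi> \<psi>
      by (auto simp: I_Or)
    show "P X \<in> {0..1}" if "X \<in> (\<inter>) V ` A" for X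
      by (rule P_range) (rule subsetD[OF sub that])
    show "P {} = 0"
      by (rule P_empty)
    \<comment> \<open>\<open>P_compl\<close> concerns complements in \<open>W\<close>; for
      complements in \<open>V\<close>, additivity splits \<open>P V = 1\<close> into the parts
      \<open>X\<close> and \<open>V - X\<close>.\<close>
    show "P (V - X) = 1 - P X" if X: "X \<in> (\<inter>) V ` A" for X
    proof -
      have "X \<in> A" "X \<subseteq> V"
        using X sub by blast+
      then have "P (X \<union> (V - X)) = P X + P (V - X)"
        using P_additive assms(1) by (intro additiveD) auto
      moreover have "X \<union> (V - X) = V"
        using \<open>X \<subseteq> V\<close> by auto
      ultimately show ?thesis
        using assms(2) by simp
    qed
    show "additive ((\<inter>) V ` A) P"
      unfolding additive_def
    proof (intro ballI impI)
      fix X Y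
      assume "X \<in> (\<inter>) V ` A" "Y \<in> (\<inter>) V ` A" "X \<inter> Y = {}"
      then show "P (X \<union> Y) = P X + P Y"
        using subsetD[OF sub] by (intro additiveD[OF P_additive])
    qed
  qed
qed

text \<open>Counting makes sense for arbitrary sets, so \<open>S\<close> need not belong to
  \<open>A\<close>, and \<open>A\<close> and \<open>I\<close> can stay as they are.\<close>

lemma prob_model_uniform:
  assumes "finite S" "S \<noteq> {}" "S \<subseteq> W"
  shows "prob_model W A I (\<lambda>X. card (X \<inter> S) / card S)"
proof unfold_locales
  have pos: "card S > 0"
    using assms by (simp add: card_gt_0_iff)
  show "W \<noteq> {}"
    by (rule worlds_nonempty)
  show "I \<phi> \<in> A" for \<phi>
    by (rule I_in)
  show "I (Neg \<phi>) = W - I \<phi>" for \<phi>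
    by (rule I_Neg)
  show "I (Or \<phi> \<psi>) = I \<phi> \<union> I \<psi>" for \<phi> \<psi>
    by (rule I_Or)
  show "card (X \<inter> S) / card S \<in> {0..1}" for X
    using pos card_mono[OF assms(1), of "X \<inter> S"] by simp
  show "card ({} \<inter> S) / card S = (0::real)"
    by simp
  show "card ((W - X) \<inter> S) / card S = 1 - card (X \<inter> S) / card S" for X
  proof -
    \<comment> \<open>Here \<open>S \<subseteq> W\<close> enters: every sample point outside
      \<open>X\<close> is counted by the complement in \<open>W\<close>.\<close>
    have "(W - X) \<inter> S = S - X \<inter> S"
      using assms(3) by auto
    then have "real (card ((W - X) \<inter> S)) = card S - real (card (X \<inter> S))"
      using assms(1) card_mono[OF assms(1), of "X \<inter> S"]
      by (simp add: card_Diff_subset)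
    then show ?thesis
      using pos by (simp add: field_simps)
  qed
  show "additive A (\<lambda>X. card (X \<inter> S) / card S)"
    unfolding additive_def
  proof (intro ballI impI)
    fix X Y :: "'w set"
    assume "X \<inter> Y = {}"
    then have "card (X \<inter> S \<union> Y \<inter> S) = card (X \<inter> S) + card (Y \<inter> S)"
      using assms(1) by (intro card_Un_disjoint) auto
    then show "card ((X \<union> Y) \<inter> S) / card S = card (X \<inter> S) / card S + real (card (Y \<inter> S)) / card S"
      by (simp add: Int_Un_distrib2 add_divide_distrib)
  qed
qed

end

theorem fact12:
  fixes \<Gamma> \<Delta> :: "fm set"
  assumes "finite \<Gamma>" and "finite \<Delta>"
  shows "preservation_valid TYPE('w) {0<..1} \<Gamma> \<Delta> \<longleftrightarrow> subvaluationistically_valid TYPE('w) \<Gamma> \<Delta>"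
proof
  assume valid: "preservation_valid TYPE('w) {0<..1} \<Gamma> \<Delta>"
  show "subvaluationistically_valid TYPE('w) \<Gamma> \<Delta>"
    unfolding subvaluationistically_valid_def
  proof (intro allI impI)
    fix W :: "'w set" and A I P
    assume "prob_model W A I P" and "\<forall>\<gamma>\<in>\<Gamma>. I \<gamma> \<noteq> {}"
    then interpret prob_model W A I P by simp
    obtain f where f: "\<forall>\<gamma>\<in>\<Gamma>. f \<gamma> \<in> I \<gamma>"
      using bchoice[of \<Gamma> "\<lambda>\<gamma> x. x \<in> I \<gamma>"] \<open>\<forall>\<gamma>\<in>\<Gamma>. I \<gamma> \<noteq> {}\<close> by blast
    obtain w where "w \<in> W"
      using worlds_nonempty by blast
    \<comment> \<open>\<open>w\<close> is needed for empty \<open>\<Gamma>\<close>.\<close>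
    define S where "S = insert w (f ` \<Gamma>)"
    have S: "finite S" "S \<noteq> {}" "S \<subseteq> W"
      using assms(1) \<open>w \<in> W\<close> f I_in sets_into_space by (auto simp: S_def)
    interpret uniform: prob_model W A I "\<lambda>X. card (X \<inter> S) / card S"
      using S by (rule prob_model_uniform)
    have "card (I \<gamma> \<inter> S) / card S \<in> {0<..1::real}" if "\<gamma> \<in> \<Gamma>" for \<gamma>
    proof -
      \<comment> \<open>The chosen witness makes the count positive; the upper bound 1 comes from
        the range axiom of the uniform model.\<close>
      have "f \<gamma> \<in> I \<gamma> \<inter> S"
        using that f by (auto simp: S_def)
      then have "card (I \<gamma> \<inter> S) > 0" "card S > 0"
        using S(1) by (auto simp: card_gt_0_iff)
      then show ?thesis
        using uniform.P_range[OF I_in, of \<gamma>] by simp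
    qed
    then obtain \<delta> where "\<delta> \<in> \<Delta>" "card (I \<delta> \<inter> S) / card S \<in> {0<..1::real}"
      using valid uniform.prob_model_axioms unfolding preservation_valid_def by blast
    then show "\<exists>\<delta>\<in>\<Delta>. I \<delta> \<noteq> {}"
      by (intro bexI[of _ \<delta>]) auto
  qed
next
  assume valid: "subvaluationistically_valid TYPE('w) \<Gamma> \<Delta>"
  show "preservation_valid TYPE('w) {0<..1} \<Gamma> \<Delta>"
    unfolding preservation_valid_def
  proof (intro allI impI)
    fix W :: "'w set" and A I P
    assume "prob_model W A I P" and prem: "\<forall>\<gamma>\<in>\<Gamma>. P (I \<gamma>) \<in> {0<..1}"
    then interpret prob_model W A I P by simp
    show "\<exists>\<delta>\<in>\<Delta>. P (I \<delta>) \<in> {0<..1}"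
    proof (rule ccontr)
      assume "\<not> ?thesis"
      \<comment> \<open>A probability lies in [0,1], so 0 is the only value it can take outside
        (0,1].\<close>
      then have null: "P (I \<delta>) = 0" if "\<delta> \<in> \<Delta>" for \<delta>
        using that P_range[OF I_in, of \<delta>] by fastforce
      define N where "N = (\<Union>\<delta>\<in>\<Delta>. I \<delta>)"
      have N: "N \<in> A" "P N = 0"
        using assms(2) I_in null by (auto simp: N_def intro!: P_null_UN)
      \<comment> \<open>\<open>P (W - N) = 1 - P N = 1\<close>. The new worlds are still of type
        \<open>'w\<close>, so the assumed validity at that type applies.\<close>
      interpret rest: prob_model "W - N" "(\<inter>) (W - N) ` A" "\<lambda>\<phi>. (W - N) \<inter> I \<phi>" P
        using N P_compl by (intro prob_model_restrict) auto
      have "(W - N) \<inter> I \<gamma> \<noteq> {}" if "\<gamma> \<in> \<Gamma>" for \<gamma>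
      proof
        assume "(W - N) \<inter> I \<gamma> = {}"
        \<comment> \<open>A premise lost by the deletion would lie inside the null set
          \<open>N\<close>, so monotonicity would contradict its positive probability.\<close>
        then have "I \<gamma> \<subseteq> N"
          using I_in[of \<gamma>] sets_into_space by blast
        then have "P (I \<gamma>) \<le> 0"
          using P_mono[OF I_in N(1)] N(2) by metis
        then show False
          using prem that by force
      qed
      then obtain \<delta> where "\<delta> \<in> \<Delta>" "(W - N) \<inter> I \<delta> \<noteq> {}"
        using valid rest.prob_model_axioms unfolding subvaluationistically_valid_def by blast
      \<comment> \<open>\<open>N\<close> contains every \<open>I \<delta>\<close>, so nothing of a
        conclusion is left outside it.\<close>
      then show False
        by (auto simp: N_def)
    qed
  qed
qed

end
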